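(* In the online resource allocation problem with resource-independent rewards and sizes described in the context, under the assumptions stated there, the expected reward of the prophet satisfies $$\mathbb E[V^{\text{off}}(\mathbf I)]=\Omega\bigl(T^{\frac1{1+\alpha}}\bigr),$$ where $\alpha$ is a positive constant satisfying $\frac1{\gamma_2}=\lambda^\alpha$. Moreover, the constant terms in $\Omega(\cdot)$ are independent of $n$, the number of possible reward values.
   Context: **Problem.** There are $m$ resources with initial capacities $c_1,\dots,c_m$ and $T$ periods. In each period $t$ one request arrives with a nonnegative reward $r^t$ and a positive size $d^t$, neither depending on the resource used; the pairs $(r^t,d^t)$ are drawn independently over $t$ from a distribution that does not depend on $t$. Put $\mathbf I=\{(r^t,d^t)\}_{t=1}^T$. The prophet value is $$V^{\text{off}}(\mathbf I)=\max\Bigl\{\sum_{t=1}^T\sum_{j=1}^mr^tx^t_j:\ \sum_{t=1}^Td^tx^t_j\le c_j\ \forall j,\ \sum_{j=1}^mx^t_j\le1\ \forall t,\ x^t_j\in\{0,1\}\Bigr\}.$$ The asymptotic statement is as $T\to\infty$, with the capacities fixed. **Assumption on rewards and sizes.** With probability $p_i$ ($i=1,\dots,n$) one has $r^t=r_i$, and then $d^t$ is a one-dimensional random variable with distribution function $F_i$. **Regularity assumption on $F_i$.** For some $\bar\omega>0$ and for all $i$, $F_i$ has a continuous density $f_i$ and: (1) there exist a constant $0<\lambda<1$ and two constants $1<\gamma_1<\gamma_2$ such that $\gamma_1F_i(\lambda w)\le F_i(w)\le\gamma_2F_i(\lambda w)$ for all $w\in(0,\bar\omega)$; (2) $w\mapsto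 w^3f_i(w)$ is non-decreasing on $(0,\bar\omega)$.
   Formalization: The claim fails if all rewards are 0 or no rewarded size is at most ω̄; so some capacity is assumed positive and Σ p_i r_i F_i(ω̄) ≥ β for a given β > 0, and the constants, uniform in n, may depend on β. *)

theory Defs
  imports "HOL-Probability.Probability"
begin

text \<open>
  Periods are \<open>t < T\<close>, resources are \<open>j < m\<close>, reward values are \<open>i < n\<close>.
  A request is a pair (reward, size), and an instance is a sequence of requests.
\<close>

definition feasible_allocation ::
  "nat \<Rightarrow> (nat \<Rightarrow> real) \<Rightarrow> nat \<Rightarrow> (nat \<Rightarrow> real \<times> real) \<Rightarrow> (nat \<Rightarrow> nat \<Rightarrow> real) \<Rightarrow> bool" where
  "feasible_allocation m c T I x \<longleftrightarrow>
     (\<forall>j<m. (\<Sum>t<T. snd (I t) * x t j) \<le> c j) \<and>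
     (\<forall>t<T. (\<Sum>j<m. x t j) \<le> 1) \<and>
     (\<forall>t<T. \<forall>j<m. x t j \<in> {0, 1})"

text \<open>
  The set of values below is finite, because a value only depends on \<open>x\<close> for \<open>t < T\<close> and
  \<open>j < m\<close>; it is nonempty for nonnegative capacities, because \<open>x = 0\<close> is then feasible.
\<close>

definition prophet_value ::
  "nat \<Rightarrow> (nat \<Rightarrow> real) \<Rightarrow> nat \<Rightarrow> (nat \<Rightarrow> real \<times> real) \<Rightarrow> real" where
  "prophet_value m c T I =
     Max {(\<Sum>t<T. \<Sum>j<m. fst (I t) * x t j) | x. feasible_allocation m c T I x}"

text \<open>
  \<open>\<mu>\<close> is the law of a single request: the reward is \<open>r i\<close> with probability \<open>p i\<close>, and given this,
  the size has distribution function \<open>F i\<close>.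
\<close>

definition request_law ::
  "nat \<Rightarrow> (nat \<Rightarrow> real) \<Rightarrow> (nat \<Rightarrow> real) \<Rightarrow> (nat \<Rightarrow> real \<Rightarrow> real) \<Rightarrow> (real \<times> real) measure \<Rightarrow> bool" where
  "request_law n p r F \<mu> \<longleftrightarrow>
     prob_space \<mu> \<and> sets \<mu> = sets borel \<and>
     (\<forall>i<n. 0 \<le> p i) \<and> (\<Sum>i<n. p i) = 1 \<and>
     (\<forall>i<n. 0 \<le> r i) \<and> inj_on r {..<n} \<and>
     (\<forall>i<n. \<forall>w. measure \<mu> ({r i} \<times> {..w}) = p i * F i w) \<and>
     (AE z in \<mu>. 0 < snd z)"

text \<open>The requests of the \<open>T\<close> periods are independent with common law \<open>\<mu>\<close>.\<close>

definition expected_prophet_value ::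
  "nat \<Rightarrow> (nat \<Rightarrow> real) \<Rightarrow> nat \<Rightarrow> (real \<times> real) measure \<Rightarrow> real" where
  "expected_prophet_value m c T \<mu> =
     (\<integral>I. prophet_value m c T I \<partial>(\<Pi>\<^sub>M t\<in>{..<T}. \<mu>))"

text \<open>
  Continuity of the density is only required on \<open>(0, w\<^sub>0)\<close>, so that for instance power laws, with
  density unbounded at 0, and uniform laws, with a jump at the right end of the support, are covered.
\<close>

definition regular_size_distribution ::
  "real \<Rightarrow> real \<Rightarrow> real \<Rightarrow> real \<Rightarrow> (real \<Rightarrow> real) \<Rightarrow> bool" where
  "regular_size_distribution w\<^sub>0 l \<gamma>\<^sub>1 \<gamma>\<^sub>2 F \<longleftrightarrow>
     (\<exists>f. f \<in> borel_measurable borel \<and> (\<forall>w. 0 \<le> f w) \<and>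
          real_distribution (density lborel (\<lambda>w. ennreal (f w))) \<and>
          F = cdf (density lborel (\<lambda>w. ennreal (f w))) \<and>
          continuous_on {0<..<w\<^sub>0} f \<and>
          mono_on {0<..<w\<^sub>0} (\<lambda>w. w ^ 3 * f w)) \<and>
     (\<forall>w\<in>{0<..<w\<^sub>0}. \<gamma>\<^sub>1 * F (l * w) \<le> F w \<and> F w \<le> \<gamma>\<^sub>2 * F (l * w))"

text \<open>
  These conditions also hold when \<open>F\<close> vanishes on \<open>(0, w\<^sub>0)\<close>. The prophet value is then bounded
  in \<open>T\<close>, as it is when all rewards vanish. The growth of the prophet value therefore needs the mean reward
  from requests of size at most \<open>w\<^sub>0\<close>, namely \<open>\<Sum>i<n. p i * r i * F i w\<^sub>0\<close>, to be positive, and the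
  constants can be uniform in \<open>n\<close> only for a given lower bound \<open>\<beta> > 0\<close> on it.
\<close>

end

theory Submission
  imports Defs
begin

text \<open>
  Choose a small size \<open>s\<close> and let the prophet serve, from a single resource \<open>k\<close> with \<open>c k > 0\<close>, only
  requests of size at most \<open>s\<close>. The regularity of the size distributions makes such requests
  frequent: iterating \<open>F w \<le> \<gamma>\<^sub>2 * F (l * w)\<close> from \<open>w\<^sub>0\<close> downwards, with
  \<open>1 / \<gamma>\<^sub>2 = l powr \<alpha>\<close>, gives \<open>F s \<ge> q * F w\<^sub>0\<close> for \<open>q = (l * s / w\<^sub>0) powr \<alpha>\<close>
  (\<open>regular_size_distribution_power_lower_bound\<close>). If exactly the fraction \<open>q * F i w\<^sub>0\<close> of the
  requests of each reward value \<open>r i\<close> is served, then a period contributes expected reward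
  \<open>q * (\<Sum>i<n. p i * r i * F i w\<^sub>0) \<ge> q * \<beta>\<close>, while the expected total size requested is at most
  \<open>T * s * q\<close>. Taking \<open>s\<close> proportional to \<open>T powr (- 1 / (1 + \<alpha>))\<close> keeps this total size at a
  fixed fraction of \<open>c k\<close>, and the expected reward \<open>T * q * \<beta>\<close> is then of order
  \<open>T powr (1 / (1 + \<alpha>))\<close>.

  Two points need care. First, \<open>F i s\<close> can be much larger than \<open>q * F i w\<^sub>0\<close> for some \<open>i\<close>, and
  then cheap requests could crowd out valuable ones. The size limit therefore depends on the
  reward: since \<open>F i\<close> is continuous, some limit \<open>b i \<le> s\<close> satisfies \<open>F i (b i) = q * F i w\<^sub>0\<close>
  exactly (\<open>regular_size_distribution_threshold\<close>). As the accepted probabilities are the same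
  multiple of \<open>p i * F i w\<^sub>0\<close> for every \<open>i\<close>, neither \<open>n\<close> nor the individual rewards enter the constants.

  Secondly, the capacity constraint has to hold for every realisation and not only on average.
  For a set \<open>S\<close> of acceptable requests, let \<open>R\<close> and
  \<open>D\<close> be the total reward and the total size of the requests in \<open>S\<close>. Then
  \<open>R * (1 - D / c k)\<close> never exceeds the prophet value (\<open>prophet_value_ge_acceptance_set\<close>). Its
  expectation involves only products over two periods, which independence evaluates
  (\<open>expected_prophet_value_ge_acceptance_set\<close>).
\<close>

section \<open>The prophet value of a fixed instance\<close>

definition allocation_value :: "nat \<Rightarrow> nat \<Rightarrow> (nat \<Rightarrow> real \<times> real) \<Rightarrow> (nat \<Rightarrow> nat \<Rightarrow> real) \<Rightarrow> real" where
  "allocation_value m T I x = (\<Sum>t<T. \<Sum>j<m. fst (I t) * x t j)"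

text \<open>
  The prophet value is a maximum over infinitely many allocations, which differ irrelevantly outside
  the \<open>T\<close> periods and \<open>m\<close> resources. Restricting to extensional functions leaves a finite index
  set that is the same for every instance; both boundedness and measurability rest on this.
\<close>

definition binary_matrices :: "nat \<Rightarrow> nat \<Rightarrow> (nat \<Rightarrow> nat \<Rightarrow> real) set" where
  "binary_matrices m T = ({..<T} \<rightarrow>\<^sub>E ({..<m} \<rightarrow>\<^sub>E {0, 1}))"

lemma finite_binary_matrices: "finite (binary_matrices m T)"
  unfolding binary_matrices_def by (intro finite_PiE) auto

lemma allocation_values_eq_image:
  "{(\<Sum>t<T. \<Sum>j<m. fst (I t) * x t j) | x. feasible_allocation m c T I x} =
     allocation_value m T I ` {x \<in> binary_matrices m T. feasible_allocation m c T I x}"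
    (is "?L = ?R")
proof
  show "?L \<subseteq> ?R"
  proof
    fix v assume "v \<in> ?L"
    then obtain x where v: "v = (\<Sum>t<T. \<Sum>j<m. fst (I t) * x t j)"
      and x: "feasible_allocation m c T I x" by auto
    define y where "y = (\<lambda>t\<in>{..<T}. \<lambda>j\<in>{..<m}. x t j)"
    have "y \<in> binary_matrices m T"
      using x by (auto simp: y_def binary_matrices_def feasible_allocation_def)
    moreover have "feasible_allocation m c T I y"
      using x by (simp add: y_def feasible_allocation_def)
    moreover have "allocation_value m T I y = v"
      by (simp add: v allocation_value_def y_def)
    ultimately show "v \<in> ?R" by blast
  qed
qed (auto simp: allocation_value_def)

lemma prophet_value_ge:
  assumes "feasible_allocation m c T I x"
  shows "allocation_value m T I x \<le> prophet_value m c T I"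
proof -
  have "finite {(\<Sum>t<T. \<Sum>j<m. fst (I t) * x t j) | x. feasible_allocation m c T I x}"
    unfolding allocation_values_eq_image using finite_binary_matrices by simp
  then show ?thesis
    unfolding prophet_value_def by (rule Max_ge) (use assms in \<open>auto simp: allocation_value_def\<close>)
qed

lemma feasible_allocation_zero:
  assumes "\<forall>j<m. 0 \<le> c j"
  shows "feasible_allocation m c T I (\<lambda>_ _. 0)"
  using assms by (simp add: feasible_allocation_def)

lemma prophet_value_nonneg:
  assumes "\<forall>j<m. 0 \<le> c j"
  shows "0 \<le> prophet_value m c T I"
  using prophet_value_ge[OF feasible_allocation_zero[OF assms]] by (simp add: allocation_value_def)

text \<open>
  Assigning the value 0 to infeasible allocations is harmless, because the zero allocation is
  feasible and has this value. It makes the index set independent of \<open>I\<close>, so that the prophet value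
  is visibly a finite maximum of measurable functions of \<open>I\<close>.
\<close>

lemma prophet_value_eq_Max:
  assumes "\<forall>j<m. 0 \<le> c j"
  shows "prophet_value m c T I =
    Max ((\<lambda>x. if feasible_allocation m c T I x then allocation_value m T I x else 0)
         ` binary_matrices m T)"
proof -
  have "0 \<in> {(\<Sum>t<T. \<Sum>j<m. fst (I t) * x t j) | x. feasible_allocation m c T I x}"
    using feasible_allocation_zero[OF assms, of T I] by force
  then have "0 \<in> allocation_value m T I ` {x \<in> binary_matrices m T. feasible_allocation m c T I x}"
    unfolding allocation_values_eq_image .
  then have "allocation_value m T I ` {x \<in> binary_matrices m T. feasible_allocation m c T I x} =
    (\<lambda>x. if feasible_allocation m c T I x then allocation_value m T I x else 0)
         ` binary_matrices m T"
    by (auto simp: image_iff)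
  then show ?thesis
    unfolding prophet_value_def allocation_values_eq_image by simp
qed

lemma prophet_value_le:
  assumes "\<forall>j<m. 0 \<le> c j"
  shows "prophet_value m c T I \<le> (\<Sum>t<T. real m * \<bar>fst (I t)\<bar>)"
proof -
  have val: "allocation_value m T I x \<le> (\<Sum>t<T. real m * \<bar>fst (I t)\<bar>)"
    if "x \<in> binary_matrices m T" for x
    unfolding allocation_value_def
  proof (rule sum_mono)
    fix t assume t: "t \<in> {..<T}"
    have "(\<Sum>j<m. fst (I t) * x t j) \<le> (\<Sum>j<m. \<bar>fst (I t)\<bar>)"
    proof (rule sum_mono)
      fix j assume "j \<in> {..<m}"
      then have "x t j \<in> {0, 1}"
        using that t by (auto simp: binary_matrices_def PiE_def Pi_def)
      then show "fst (I t) * x t j \<le> \<bar>fst (I t)\<bar>" by auto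
    qed
    then show "(\<Sum>j<m. fst (I t) * x t j) \<le> real m * \<bar>fst (I t)\<bar>" by simp
  qed
  have "binary_matrices m T \<noteq> {}"
    by (auto simp: binary_matrices_def PiE_eq_empty_iff)
  moreover have "0 \<le> (\<Sum>t<T. real m * \<bar>fst (I t)\<bar>)"
    by (intro sum_nonneg) simp
  ultimately show ?thesis
    unfolding prophet_value_eq_Max[OF assms]
    using finite_binary_matrices val by (subst Max_le_iff) auto
qed

text \<open>
  Either all requests in \<open>S\<close> fit into resource \<open>k\<close>, and serving them there earns the whole first
  factor; or they do not, and then the second factor is negative while the prophet value is not.
\<close>

lemma prophet_value_ge_acceptance_set:
  assumes c: "\<forall>j<m. 0 \<le> c j" and k: "k < m" "0 < c k"
    and S: "\<And>z. z \<in> S \<Longrightarrow> 0 \<le> fst z \<and> 0 \<le> snd z"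
  shows "(\<Sum>t<T. fst (I t) * indicator S (I t)) * (1 - (\<Sum>t<T. snd (I t) * indicator S (I t)) / c k)
           \<le> prophet_value m c T I"
    (is "?R * (1 - ?D / c k) \<le> _")
proof -
  have nonneg: "0 \<le> fst z * indicator S z" "0 \<le> snd z * indicator S z" for z
    using S[of z] by (cases "z \<in> S"; simp)+
  have R: "0 \<le> ?R" and D: "0 \<le> ?D"
    by (intro sum_nonneg nonneg)+
  show ?thesis
  proof (cases "?D \<le> c k")
    case True
    define x :: "nat \<Rightarrow> nat \<Rightarrow> real" where "x = (\<lambda>t j. if j = k then indicator S (I t) else 0)"
    have x: "(\<Sum>j<m. x t j) = indicator S (I t)" for t
      using k by (simp add: x_def)
    have "(\<Sum>t<T. snd (I t) * x t j) \<le> c j" if "j < m" for j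
    proof (cases "j = k")
      case j: True
      show ?thesis unfolding x_def using True by (simp only: j simp_thms if_True)
    next
      case False
      then show ?thesis using c that by (simp add: x_def)
    qed
    moreover have "x t j \<in> {0, 1}" for t j
      by (simp add: x_def indicator_def)
    ultimately have "feasible_allocation m c T I x"
      unfolding feasible_allocation_def x by (simp add: indicator_def)
    moreover have "allocation_value m T I x = ?R"
      by (simp add: allocation_value_def x flip: sum_distrib_left)
    ultimately have "?R \<le> prophet_value m c T I"
      using prophet_value_ge by metis
    moreover have "?R * (1 - ?D / c k) \<le> ?R"
      using R D k True by (intro mult_right_le_one_le) (simp_all del: sum_mult_indicator)
    ultimately show ?thesis by linarith
  next
    case False
    then have "?R * (1 - ?D / c k) \<le> 0"
      using R k by (intro mult_nonneg_nonpos) auto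
    then show ?thesis
      using prophet_value_nonneg[OF c, of T I] by linarith
  qed
qed

section \<open>Expectations over independent requests\<close>

lemma borel_measurable_fst_snd_request:
  assumes "sets \<mu> = sets (borel :: (real \<times> real) measure)"
  shows "fst \<in> borel_measurable \<mu>" "snd \<in> borel_measurable \<mu>"
  by (simp_all add: measurable_cong_sets[OF assms refl] borel_measurable_continuous_onI
      continuous_on_fst continuous_on_snd)

lemma borel_measurable_prophet_value:
  assumes "sets \<mu> = sets (borel :: (real \<times> real) measure)" and c: "\<forall>j<m. 0 \<le> c j"
  shows "prophet_value m c T \<in> borel_measurable (\<Pi>\<^sub>M t\<in>{..<T}. \<mu>)"
proof -
  note [measurable] = borel_measurable_fst_snd_request[OF assms(1)]
  have [measurable]: "Measurable.pred (\<Pi>\<^sub>M t\<in>{..<T}. \<mu>) (\<lambda>I. feasible_allocation m c T I x)" for x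
    unfolding feasible_allocation_def by measurable
  have [measurable]: "(\<lambda>I. allocation_value m T I x) \<in> borel_measurable (\<Pi>\<^sub>M t\<in>{..<T}. \<mu>)" for x
    unfolding allocation_value_def by measurable
  show ?thesis
    unfolding prophet_value_eq_Max[OF c, abs_def]
    by (intro borel_measurable_Max finite_binary_matrices) measurable
qed


lemma has_bochner_integral_PiM_component:
  fixes g :: "'a \<Rightarrow> real"
  assumes "prob_space \<mu>" "i \<in> I" "integrable \<mu> g"
  shows "has_bochner_integral (\<Pi>\<^sub>M i\<in>I. \<mu>) (\<lambda>\<omega>. g (\<omega> i)) (integral\<^sup>L \<mu> g)"
proof -
  have d: "distr (\<Pi>\<^sub>M i\<in>I. \<mu>) \<mu> (\<lambda>\<omega>. \<omega> i) = \<mu>"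
    using distr_PiM_component[of I "\<lambda>_. \<mu>" i] assms by simp
  have [measurable]: "g \<in> borel_measurable \<mu>" "(\<lambda>\<omega>. \<omega> i) \<in> measurable (\<Pi>\<^sub>M i\<in>I. \<mu>) \<mu>"
    using assms by auto
  have "integrable (distr (\<Pi>\<^sub>M i\<in>I. \<mu>) \<mu> (\<lambda>\<omega>. \<omega> i)) g"
    unfolding d by fact
  then have "integrable (\<Pi>\<^sub>M i\<in>I. \<mu>) (\<lambda>\<omega>. g (\<omega> i))"
    by (subst (asm) integrable_distr_eq) auto
  moreover have "(\<integral>\<omega>. g (\<omega> i) \<partial>(\<Pi>\<^sub>M i\<in>I. \<mu>)) = integral\<^sup>L (distr (\<Pi>\<^sub>M i\<in>I. \<mu>) \<mu> (\<lambda>\<omega>. \<omega> i)) g"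
    by (subst integral_distr) auto
  ultimately show ?thesis
    unfolding d by (simp add: has_bochner_integral_iff)
qed

lemma has_bochner_integral_PiM_two_components:
  fixes g h :: "'a \<Rightarrow> real"
  assumes "prob_space \<mu>" "finite I" "i \<in> I" "j \<in> I" "i \<noteq> j" "integrable \<mu> g" "integrable \<mu> h"
  shows "has_bochner_integral (\<Pi>\<^sub>M i\<in>I. \<mu>) (\<lambda>\<omega>. g (\<omega> i) * h (\<omega> j))
           (integral\<^sup>L \<mu> g * integral\<^sup>L \<mu> h)"
proof -
  interpret prob_space \<mu> by fact
  interpret product_sigma_finite "\<lambda>_. \<mu>" ..
  \<comment> \<open>The product of two factors is a product over all of \<open>I\<close>, with factor 1 elsewhere.\<close>
  define f where "f k = (if k = i then g else if k = j then h else (\<lambda>_. 1))" for k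
  have f: "integrable \<mu> (f k)" for k
    using assms by (simp add: f_def)
  have two: "(\<Prod>k\<in>I. u k) = u i * u j" if "\<And>k. k \<noteq> i \<Longrightarrow> k \<noteq> j \<Longrightarrow> u k = 1" for u :: "_ \<Rightarrow> real"
  proof -
    have "(\<Prod>k\<in>I. u k) = (\<Prod>k\<in>{i, j}. u k)"
      using assms that by (intro prod.mono_neutral_right) auto
    then show ?thesis using assms by simp
  qed
  have "(\<lambda>\<omega>. \<Prod>k\<in>I. f k (\<omega> k)) = (\<lambda>\<omega>. g (\<omega> i) * h (\<omega> j))"
    using assms by (subst two) (auto simp: f_def)
  moreover have "(\<Prod>k\<in>I. integral\<^sup>L \<mu> (f k)) = integral\<^sup>L \<mu> g * integral\<^sup>L \<mu> h"
    using assms by (subst two) (auto simp: f_def prob_space)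
  ultimately show ?thesis
    using product_integrable_prod[of I f] product_integral_prod[of I f] f \<open>finite I\<close>
    by (simp add: has_bochner_integral_iff)
qed

text \<open>
  Expanding the product in the pointwise bound gives terms for pairs of periods. A pair of distinct
  periods contributes, by independence, the product of the mean reward and the mean size in \<open>S\<close>, and the
  latter is at most \<open>s * measure \<mu> S\<close>. A pair of equal periods contributes at most \<open>s\<close> times the
  mean reward, whence the summand \<open>s\<close> next to \<open>real T * (s * measure \<mu> S)\<close>. Integrability of the
  reward makes the prophet value integrable, without which its integral would be 0 by convention.
\<close>

lemma expected_prophet_value_ge_acceptance_set:
  fixes S :: "(real \<times> real) set"
  assumes \<mu>: "prob_space \<mu>" "sets \<mu> = sets borel" and int: "integrable \<mu> fst"
    and c: "\<forall>j<m. 0 \<le> c j" and k: "k < m" "0 < c k"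
    and S: "S \<in> sets borel" "\<And>z. z \<in> S \<Longrightarrow> 0 \<le> fst z \<and> 0 \<le> snd z \<and> snd z \<le> s" and s: "0 \<le> s"
  shows "real T * (\<integral>z. fst z * indicator S z \<partial>\<mu>) * (1 - (s + real T * (s * measure \<mu> S)) / c k)
           \<le> expected_prophet_value m c T \<mu>"
proof -
  interpret prob_space \<mu> by fact
  note [measurable] = borel_measurable_fst_snd_request[OF \<mu>(2)]
  have [measurable]: "S \<in> sets \<mu>" using S \<mu> by simp
  define P where "P = (\<Pi>\<^sub>M t\<in>{..<T}. \<mu>)"
  define g :: "real \<times> real \<Rightarrow> real" where "g z = fst z * indicator S z" for z
  define h :: "real \<times> real \<Rightarrow> real" where "h z = snd z * indicator S z" for z
  define \<rho> where "\<rho> = integral\<^sup>L \<mu> g"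
  define \<delta> where "\<delta> = integral\<^sup>L \<mu> h"
  have g0: "0 \<le> g z" and h0: "0 \<le> h z" and hs: "h z \<le> s * indicator S z" and hs': "h z \<le> s" for z
    using S(2) s by (auto simp: g_def h_def indicator_def)
  have [measurable]: "g \<in> borel_measurable \<mu>" "h \<in> borel_measurable \<mu>"
    unfolding g_def h_def by measurable
  have ig: "integrable \<mu> g"
    using int by (rule Bochner_Integration.integrable_bound) (auto simp: g_def indicator_def)
  have ih: "integrable \<mu> h"
    by (rule integrable_const_bound[where B = s]) (use h0 hs' in auto)
  have igh: "integrable \<mu> (\<lambda>z. g z * h z)"
  proof (rule Bochner_Integration.integrable_bound)
    show "integrable \<mu> (\<lambda>z. s * g z)" using ig by simp
    show "AE z in \<mu>. norm (g z * h z) \<le> norm (s * g z)"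
      using g0 h0 hs' s by (intro AE_I2) (simp add: abs_mult mult.commute[of s] mult_left_mono)
  qed simp
  have \<rho>0: "0 \<le> \<rho>" unfolding \<rho>_def using g0 by simp
  have \<delta>: "\<delta> \<le> s * measure \<mu> S"
  proof -
    have "\<delta> \<le> (\<integral>z. s * indicator S z \<partial>\<mu>)"
      unfolding \<delta>_def using ih hs by (intro integral_mono) (auto simp: less_top[symmetric])
    then show ?thesis by simp
  qed
  have diag: "(\<integral>z. g z * h z \<partial>\<mu>) \<le> s * \<rho>"
  proof -
    have "(\<integral>z. g z * h z \<partial>\<mu>) \<le> (\<integral>z. s * g z \<partial>\<mu>)"
      using ig igh g0 hs' by (intro integral_mono) (simp_all add: mult.commute[of s] mult_left_mono)
    then show ?thesis by (simp add: \<rho>_def)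
  qed
  \<comment> \<open>The pointwise lower bound, with the product of the two sums expanded.\<close>
  define W where "W I = (\<Sum>t<T. g (I t)) - (\<Sum>t<T. \<Sum>u<T. g (I t) * h (I u)) / c k" for I
  define e where "e t u = (if t = u then \<integral>z. g z * h z \<partial>\<mu> else \<rho> * \<delta>)" for t u :: nat
  have gh: "has_bochner_integral P (\<lambda>I. g (I t) * h (I u)) (e t u)" if "t < T" "u < T" for t u
  proof (cases "t = u")
    case True
    with that has_bochner_integral_PiM_component[OF \<mu>(1) _ igh, of t "{..<T}"] show ?thesis
      by (simp add: e_def P_def)
  next
    case False
    with that has_bochner_integral_PiM_two_components[OF \<mu>(1) _ _ _ False ig ih, of "{..<T}"]
    show ?thesis by (simp add: e_def P_def \<rho>_def \<delta>_def)
  qed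
  have g1: "has_bochner_integral P (\<lambda>I. g (I t)) \<rho>" if "t < T" for t
    using has_bochner_integral_PiM_component[OF \<mu>(1) _ ig, of t "{..<T}"] that
    by (simp add: P_def \<rho>_def)
  have W: "has_bochner_integral P W ((\<Sum>t<T. \<rho>) - (\<Sum>t<T. \<Sum>u<T. e t u) / c k)"
    unfolding W_def[abs_def]
    by (intro has_bochner_integral_diff has_bochner_integral_sum has_bochner_integral_divide)
      (auto intro: gh g1)
  have e: "e t u \<le> \<rho> * (s * measure \<mu> S) + (if t = u then s * \<rho> else 0)" for t u
    using diag mult_left_mono[OF \<delta> \<rho>0] \<rho>0 s by (auto simp: e_def intro: add_increasing)
  have "(\<Sum>t<T. \<Sum>u<T. e t u) \<le>
      (\<Sum>t<T. \<Sum>u<T. \<rho> * (s * measure \<mu> S) + (if t = u then s * \<rho> else 0))"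
    by (intro sum_mono e)
  also have "\<dots> = real T * \<rho> * (s + real T * (s * measure \<mu> S))"
    by (simp add: sum.distrib algebra_simps)
  finally have "(\<Sum>t<T. \<Sum>u<T. e t u) / c k
      \<le> real T * \<rho> * (s + real T * (s * measure \<mu> S)) / c k"
    using k by (intro divide_right_mono) auto
  then have "real T * \<rho> * (1 - (s + real T * (s * measure \<mu> S)) / c k)
      \<le> (\<Sum>t<T. \<rho>) - (\<Sum>t<T. \<Sum>u<T. e t u) / c k"
    by (simp add: right_diff_distrib)
  also have "\<dots> = integral\<^sup>L P W"
    using W by (simp add: has_bochner_integral_iff)
  also have "\<dots> \<le> integral\<^sup>L P (prophet_value m c T)"
  proof (rule integral_mono)
    show "integrable P W" using W by (simp add: has_bochner_integral_iff)
    have "has_bochner_integral P (\<lambda>I. \<Sum>t<T. real m * \<bar>fst (I t)\<bar>)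
        (\<Sum>t<T. real m * integral\<^sup>L \<mu> (\<lambda>z. \<bar>fst z\<bar>))"
      unfolding P_def
      by (intro has_bochner_integral_sum has_bochner_integral_mult_right
          has_bochner_integral_PiM_component[OF \<mu>(1) _ integrable_abs[OF int]])
    then have "integrable P (\<lambda>I. \<Sum>t<T. real m * \<bar>fst (I t)\<bar>)"
      by (simp add: has_bochner_integral_iff)
    then show "integrable P (prophet_value m c T)"
    proof (rule Bochner_Integration.integrable_bound)
      show "prophet_value m c T \<in> borel_measurable P"
        unfolding P_def by (rule borel_measurable_prophet_value[OF \<mu>(2) c])
      show "AE I in P. norm (prophet_value m c T I) \<le> norm (\<Sum>t<T. real m * \<bar>fst (I t)\<bar>)"
        using prophet_value_nonneg[OF c, of T] prophet_value_le[OF c, of T]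
        by (intro AE_I2) (auto intro: order_trans[OF _ abs_ge_self])
    qed
    show "W I \<le> prophet_value m c T I" for I
    proof -
      have "W I = (\<Sum>t<T. g (I t)) * (1 - (\<Sum>t<T. h (I t)) / c k)"
        by (simp add: W_def right_diff_distrib sum_product)
      also have "\<dots> \<le> prophet_value m c T I"
        unfolding g_def h_def using S(2) by (intro prophet_value_ge_acceptance_set[OF c k]) blast
      finally show ?thesis .
    qed
  qed
  finally show ?thesis
    by (simp add: P_def \<rho>_def g_def[abs_def] expected_prophet_value_def)
qed

section \<open>Size distributions\<close>

lemma regular_size_distribution_cdf:
  assumes "regular_size_distribution w\<^sub>0 l \<gamma>\<^sub>1 \<gamma>\<^sub>2 F"
  shows "continuous_on UNIV F" "mono F" "0 \<le> F w" "F w \<le> 1"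
    "(F \<longlongrightarrow> 0) at_bot" "(\<lambda>k. F (real k)) \<longlonglongrightarrow> 1"
proof -
  from assms obtain f where f: "f \<in> borel_measurable borel"
    and rd: "real_distribution (density lborel (\<lambda>w. ennreal (f w)))"
    and F: "F = cdf (density lborel (\<lambda>w. ennreal (f w)))"
    unfolding regular_size_distribution_def by blast
  interpret real_distribution "density lborel (\<lambda>w. ennreal (f w))" by fact
  have "emeasure (density lborel (\<lambda>w. ennreal (f w))) {x} = 0" for x
    using f by (subst emeasure_density) (auto simp: nn_integral_0_iff_AE AE_lborel_singleton
        indicator_def intro: eventually_mono[OF AE_lborel_singleton[of x]])
  then show "continuous_on UNIV F"
    unfolding F by (auto intro!: continuous_at_imp_continuous_on simp: isCont_cdf measure_def)
  show "mono F" "0 \<le> F w" "F w \<le> 1" "(F \<longlongrightarrow> 0) at_bot" "(\<lambda>k. F (real k)) \<longlonglongrightarrow> 1"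
    unfolding F
    using cdf_nondecreasing cdf_nonneg cdf_bounded_prob cdf_lim_at_bot cdf_lim_infty_prob
    by (auto intro: monoI)
qed

text \<open>
  The upper ratio bound is given on the open interval only; continuity of \<open>F\<close> extends it to
  \<open>w = w\<^sub>0\<close>, where the iteration towards small sizes starts.
\<close>

lemma regular_size_distribution_doubling:
  assumes F: "regular_size_distribution w\<^sub>0 l \<gamma>\<^sub>1 \<gamma>\<^sub>2 F" and w: "0 < w" "w \<le> w\<^sub>0"
  shows "F w \<le> \<gamma>\<^sub>2 * F (l * w)"
proof -
  have "(F \<longlongrightarrow> F w) (at_left w)" "((\<lambda>v. \<gamma>\<^sub>2 * F (l * v)) \<longlongrightarrow> \<gamma>\<^sub>2 * F (l * w)) (at_left w)"
    using regular_size_distribution_cdf(1)[OF F]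
    by (auto intro!: tendsto_intros isCont_tendsto_compose[of _ F] simp: continuous_on_eq_continuous_at
        intro: filterlim_mono[OF _ order_refl at_le, of _ _ w UNIV] simp: isCont_def)
  moreover have "eventually (\<lambda>v. v \<in> {0<..<w}) (at_left w)"
    using w(1) eventually_at_left_real by blast
  then have "eventually (\<lambda>v. F v \<le> \<gamma>\<^sub>2 * F (l * v)) (at_left w)"
    by eventually_elim (use F w in \<open>auto simp: regular_size_distribution_def\<close>)
  ultimately show ?thesis
    using tendsto_le[of "at_left w"] trivial_limit_at_left_real by blast
qed

text \<open>
  Along the geometric sequence \<open>l ^ k * w\<^sub>0\<close> each step costs a factor \<open>1 / \<gamma>\<^sub>2 = l powr \<alpha>\<close>, so that
  \<open>F\<close> decays at most like the power \<open>\<alpha>\<close>. Rounding \<open>s\<close> down to a member of the sequence loses at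
  most one further step; this is the additional factor \<open>l\<close>.
\<close>

lemma regular_size_distribution_power_lower_bound:
  assumes F: "regular_size_distribution w\<^sub>0 l \<gamma>\<^sub>1 \<gamma>\<^sub>2 F"
    and l: "0 < l" "l < 1" and \<alpha>: "0 < \<alpha>" "1 / \<gamma>\<^sub>2 = l powr \<alpha>" and s: "0 < s" "s \<le> w\<^sub>0"
  shows "(l * s / w\<^sub>0) powr \<alpha> * F w\<^sub>0 \<le> F s"
proof -
  have \<gamma>\<^sub>2: "0 < \<gamma>\<^sub>2"
    using \<alpha>(2) l by (metis powr_gt_zero zero_less_divide_1_iff less_irrefl)
  have geo: "(l ^ k) powr \<alpha> * F w\<^sub>0 \<le> F (l ^ k * w\<^sub>0)" for k
  proof (induction k)
    case (Suc k)
    have "F (l ^ k * w\<^sub>0) \<le> \<gamma>\<^sub>2 * F (l * (l ^ k * w\<^sub>0))"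
      using l s by (intro regular_size_distribution_doubling[OF F])
        (auto simp: mult_le_cancel_right1 power_le_one mult_left_le_one_le)
    then have "F (l ^ k * w\<^sub>0) * l powr \<alpha> \<le> F (l ^ Suc k * w\<^sub>0)"
      using \<gamma>\<^sub>2 by (simp flip: \<alpha>(2) add: field_simps)
    moreover have "(l ^ Suc k) powr \<alpha> * F w\<^sub>0 \<le> F (l ^ k * w\<^sub>0) * l powr \<alpha>"
      using mult_right_mono[OF Suc, of "l powr \<alpha>"] l by (simp add: powr_mult mult_ac)
    ultimately show ?case by linarith
  qed (use l in simp)
  have "0 < s / w\<^sub>0" using s by simp
  then obtain k0 where "l ^ k0 < s / w\<^sub>0"
    using real_arch_pow_inv[of "s / w\<^sub>0" l] l by auto
  \<comment> \<open>The largest member of the geometric sequence that does not exceed \<open>s\<close>.\<close>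
  define k where "k = (LEAST k. l ^ k \<le> s / w\<^sub>0)"
  have k: "l ^ k \<le> s / w\<^sub>0"
    unfolding k_def by (rule LeastI[of _ k0]) (use \<open>l ^ k0 < s / w\<^sub>0\<close> in simp)
  have "l * (s / w\<^sub>0) \<le> l ^ k"
  proof (cases k)
    case 0
    have "l * (s / w\<^sub>0) \<le> 1 * 1" using l s by (intro mult_mono) auto
    then show ?thesis using 0 by simp
  next
    case (Suc j)
    have "\<not> l ^ j \<le> s / w\<^sub>0"
      using not_less_Least[of j "\<lambda>k. l ^ k \<le> s / w\<^sub>0"] Suc by (simp add: k_def)
    then show ?thesis using Suc l mult_left_mono[of "s / w\<^sub>0" "l ^ j" l] by simp
  qed
  then have "(l * s / w\<^sub>0) powr \<alpha> \<le> (l ^ k) powr \<alpha>"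
    using \<alpha> l s by (intro powr_mono2) auto
  then have "(l * s / w\<^sub>0) powr \<alpha> * F w\<^sub>0 \<le> (l ^ k) powr \<alpha> * F w\<^sub>0"
    using regular_size_distribution_cdf(3)[OF F] by (rule mult_right_mono)
  also have "\<dots> \<le> F (l ^ k * w\<^sub>0)" by (rule geo)
  also have "\<dots> \<le> F s"
    using k s by (intro monoD[OF regular_size_distribution_cdf(2)[OF F]]) (simp add: field_simps)
  finally show ?thesis .
qed

text \<open>
  This size limit equalises the reward values: whatever the shape of \<open>F\<close>, the accepted probability
  is the same multiple of \<open>F w\<^sub>0\<close>.
\<close>

lemma regular_size_distribution_threshold:
  assumes F: "regular_size_distribution w\<^sub>0 l \<gamma>\<^sub>1 \<gamma>\<^sub>2 F"
    and l: "0 < l" "l < 1" and \<alpha>: "0 < \<alpha>" "1 / \<gamma>\<^sub>2 = l powr \<alpha>" and s: "0 < s" "s \<le> w\<^sub>0"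
  shows "\<exists>b\<le>s. F b = (l * s / w\<^sub>0) powr \<alpha> * F w\<^sub>0"
proof (cases "F w\<^sub>0 = 0")
  case True
  then have "F s = 0"
    using regular_size_distribution_cdf(2,3)[OF F] s by (metis antisym monoD)
  with True show ?thesis by auto
next
  case False
  let ?q = "(l * s / w\<^sub>0) powr \<alpha> * F w\<^sub>0"
  have "0 < ?q"
    using False regular_size_distribution_cdf(3)[OF F, of w\<^sub>0] l s by (simp add: less_le)
  with regular_size_distribution_cdf(5)[OF F] have "eventually (\<lambda>v. F v < ?q) at_bot"
    by (simp add: order_tendsto_iff)
  with eventually_le_at_bot[of s] have "eventually (\<lambda>v. F v < ?q \<and> v \<le> s) at_bot"
    by eventually_elim auto
  then obtain v where "F v < ?q" "v \<le> s"
    using eventually_happens trivial_limit_at_bot_linorder by blast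
  moreover have "?q \<le> F s"
    by (rule regular_size_distribution_power_lower_bound[OF assms])
  ultimately have "\<exists>b. v \<le> b \<and> b \<le> s \<and> F b = ?q"
    using regular_size_distribution_cdf(1)[OF F]
    by (intro IVT') (auto intro: continuous_on_subset)
  then show ?thesis by blast
qed

section \<open>The law of a request\<close>

lemma request_law_reward_probability:
  assumes law: "request_law n p r F \<mu>" and lim: "(\<lambda>k. F i (real k)) \<longlonglongrightarrow> 1" and i: "i < n"
  shows "measure \<mu> ({r i} \<times> UNIV) = p i"
proof -
  have \<mu>: "prob_space \<mu>" "sets \<mu> = sets borel"
    and m: "measure \<mu> ({r i} \<times> {..w}) = p i * F i w" for w
    using law i by (auto simp: request_law_def)
  interpret prob_space \<mu> by fact
  have "(\<lambda>k. measure \<mu> ({r i} \<times> {..real k})) \<longlonglongrightarrow> measure \<mu> (\<Union>k. {r i} \<times> {..real k})"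
    by (rule finite_Lim_measure_incseq)
      (auto simp: \<mu> incseq_def intro!: borel_closed closed_Times)
  moreover have "(\<Union>k. {r i} \<times> {..real k}) = {r i} \<times> UNIV"
    using real_arch_simple by auto
  moreover have "(\<lambda>k. p i * F i (real k)) \<longlonglongrightarrow> p i * 1"
    by (intro tendsto_intros lim)
  ultimately show ?thesis
    by (simp add: m LIMSEQ_unique)
qed

text \<open>
  The rewards \<open>r i\<close> are distinct and the \<open>p i\<close> add up to 1, so that almost surely the reward is one of
  finitely many values.
\<close>

lemma request_law_integrable_reward:
  assumes law: "request_law n p r F \<mu>" and lim: "\<And>i. i < n \<Longrightarrow> (\<lambda>k. F i (real k)) \<longlonglongrightarrow> 1"
  shows "integrable \<mu> fst"
proof -
  have \<mu>: "prob_space \<mu>" "sets \<mu> = sets borel" and r: "inj_on r {..<n}" "\<And>i. i < n \<Longrightarrow> 0 \<le> r i"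
    and p: "(\<Sum>i<n. p i) = 1"
    using law by (auto simp: request_law_def)
  interpret prob_space \<mu> by fact
  note [measurable] = borel_measurable_fst_snd_request[OF \<mu>(2)]
  have "prob (\<Union>i\<in>{..<n}. {r i} \<times> UNIV) = (\<Sum>i<n. prob ({r i} \<times> UNIV))"
    using r by (intro finite_measure_finite_Union)
      (auto simp: \<mu> disjoint_family_on_def inj_on_def intro!: borel_closed closed_Times)
  also have "\<dots> = 1"
    using request_law_reward_probability[OF law lim] p by simp
  finally have "AE z in \<mu>. z \<in> (\<Union>i\<in>{..<n}. {r i} \<times> UNIV)"
    by (rule AE_prob_1)
  then have "AE z in \<mu>. norm (fst z) \<le> (\<Sum>i<n. r i)"
  proof eventually_elim
    case (elim z)
    then obtain i where "i < n" "fst z = r i" by auto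
    with r member_le_sum[of i "{..<n}" r] show ?case by auto
  qed
  then show ?thesis by (rule integrable_const_bound) simp
qed

text \<open>
  The boxes are disjoint because the rewards are distinct. Excluding the sizes \<open>\<le> 0\<close>, a null set,
  makes the sizes in \<open>S\<close> nonnegative without exception, as the pointwise bound demands, and leaves
  the probability \<open>p i * F i (b i)\<close> of each box unchanged.
\<close>

lemma request_law_thresholds:
  fixes b :: "nat \<Rightarrow> real"
  assumes law: "request_law n p r F \<mu>"
  defines "S \<equiv> \<Union>i<n. {r i} \<times> {0<..b i}"
  shows "S \<in> sets borel"
    and "measure \<mu> S = (\<Sum>i<n. p i * F i (b i))"
    and "(\<integral>z. fst z * indicator S z \<partial>\<mu>) = (\<Sum>i<n. r i * (p i * F i (b i)))"
proof -
  have \<mu>: "prob_space \<mu>" "sets \<mu> = sets borel" and r: "inj_on r {..<n}"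
    and m: "\<And>i w. i < n \<Longrightarrow> measure \<mu> ({r i} \<times> {..w}) = p i * F i w"
    and pos: "AE z in \<mu>. 0 < snd z"
    using law by (auto simp: request_law_def)
  interpret prob_space \<mu> by fact
  note [measurable] = borel_measurable_fst_snd_request[OF \<mu>(2)]
  have box: "{x} \<times> A \<in> sets borel" if "A \<in> sets borel" for x :: real and A :: "real set"
    using that by (simp add: borel_prod[symmetric])
  have meas: "{r i} \<times> {0<..b i} \<in> sets \<mu>" for i
    using box by (simp add: \<mu>)
  show "S \<in> sets borel"
    unfolding S_def by (intro sets.finite_UN) (auto intro: box)
  have prob: "prob ({r i} \<times> {0<..b i}) = p i * F i (b i)" if "i < n" for i
  proof -
    have "prob ({r i} \<times> {0<..b i}) = prob ({r i} \<times> {..b i})"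
      using pos by (intro finite_measure_eq_AE) (auto simp: \<mu> intro: box elim: eventually_mono)
    then show ?thesis using m that by simp
  qed
  have disj: "disjoint_family_on (\<lambda>i. {r i} \<times> {0<..b i}) {..<n}"
    using r by (auto simp: disjoint_family_on_def inj_on_def)
  have "prob S = (\<Sum>i<n. prob ({r i} \<times> {0<..b i}))"
    unfolding S_def using meas disj by (intro finite_measure_finite_Union) auto
  then show "prob S = (\<Sum>i<n. p i * F i (b i))"
    using prob by simp
  have "fst z * indicator S z = (\<Sum>i<n. r i * indicator ({r i} \<times> {0<..b i}) z)" for z
  proof -
    have "indicator S z = (\<Sum>i<n. indicator ({r i} \<times> {0<..b i}) z :: real)"
      unfolding S_def using disj by (intro indicator_UN_disjoint) auto
    then have "fst z * indicator S z = (\<Sum>i<n. fst z * indicator ({r i} \<times> {0<..b i}) z)"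
      by (simp only: sum_distrib_left)
    also have "\<dots> = (\<Sum>i<n. r i * indicator ({r i} \<times> {0<..b i}) z)"
      by (intro sum.cong refl) (auto split: split_indicator)
    finally show ?thesis .
  qed
  then have "(\<integral>z. fst z * indicator S z \<partial>\<mu>)
      = (\<integral>z. (\<Sum>i<n. r i * indicator ({r i} \<times> {0<..b i}) z) \<partial>\<mu>)"
    by (simp only:)
  also have "\<dots> = (\<Sum>i<n. \<integral>z. r i * indicator ({r i} \<times> {0<..b i}) z \<partial>\<mu>)"
    using meas by (intro Bochner_Integration.integral_sum) (auto simp: less_top[symmetric])
  also have "\<dots> = (\<Sum>i<n. r i * (p i * F i (b i)))"
    using meas prob by simp
  finally show "(\<integral>z. fst z * indicator S z \<partial>\<mu>) = (\<Sum>i<n. r i * (p i * F i (b i)))" .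
qed

section \<open>Growth of the expected prophet value\<close>

theorem theorem5:
  fixes m :: nat and c :: "nat \<Rightarrow> real" and w\<^sub>0 l \<gamma>\<^sub>1 \<gamma>\<^sub>2 \<alpha> \<beta> :: real
  assumes "\<forall>j<m. 0 \<le> c j" and "\<exists>j<m. 0 < c j"
    and "0 < w\<^sub>0" and "0 < l" and "l < 1" and "1 < \<gamma>\<^sub>1" and "\<gamma>\<^sub>1 < \<gamma>\<^sub>2"
    and "0 < \<alpha>" and "1 / \<gamma>\<^sub>2 = l powr \<alpha>"
    and "0 < \<beta>"
  shows "\<exists>\<kappa>>0. \<exists>T\<^sub>0. \<forall>n p r F \<mu>.
           request_law n p r F \<mu> \<and>
           (\<forall>i<n. regular_size_distribution w\<^sub>0 l \<gamma>\<^sub>1 \<gamma>\<^sub>2 (F i)) \<and>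
           \<beta> \<le> (\<Sum>i<n. p i * r i * F i w\<^sub>0) \<longrightarrow>
           (\<forall>T\<ge>T\<^sub>0. \<kappa> * real T powr (1 / (1 + \<alpha>)) \<le> expected_prophet_value m c T \<mu>)"
proof -
  obtain k where k: "k < m" "0 < c k" using assms by blast
  define e where "e = 1 / (1 + \<alpha>)"
  define C where "C = (l / w\<^sub>0) powr \<alpha>"
  \<comment> \<open>With \<open>s = a * T powr (- e)\<close> this value of \<open>a\<close> makes the bound \<open>T * s * q\<close> on the expected load exactly
    a quarter of the capacity; another quarter is left for the equal pairs of periods.\<close>
  define a where "a = (c k / (4 * C)) powr e"
  define \<kappa> where "\<kappa> = \<beta> * C * a powr \<alpha> / 2"
  have e: "0 < e" "e + e * \<alpha> = 1"
    using \<open>0 < \<alpha>\<close> by (auto simp: e_def field_simps)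
  have C: "0 < C" using assms by (simp add: C_def)
  have a: "0 < a" using C k by (simp add: a_def)
  have "a powr (1 + \<alpha>) = c k / (4 * C)"
    using \<open>0 < \<alpha>\<close> C k by (simp add: a_def e_def powr_powr)
  then have aC: "a * a powr \<alpha> * C = c k / 4"
    using a C by (simp add: powr_add field_simps)
  have \<kappa>: "0 < \<kappa>" using a C assms by (simp add: \<kappa>_def)
  have "((\<lambda>T. a * real T powr (- e)) \<longlongrightarrow> a * 0) sequentially"
    by (intro tendsto_mult tendsto_const tendsto_neg_powr filterlim_real_sequentially) (use e in simp)
  then have "eventually (\<lambda>T. a * real T powr (- e) < min w\<^sub>0 (c k / 4)) sequentially"
    using assms k by (intro order_tendstoD) auto
  then obtain N where N: "\<And>T. T \<ge> N \<Longrightarrow> a * real T powr (- e) < min w\<^sub>0 (c k / 4)"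
    unfolding eventually_sequentially by blast
  have "\<kappa> * real T powr (1 / (1 + \<alpha>)) \<le> expected_prophet_value m c T \<mu>"
    if law: "request_law n p r F \<mu>"
      and F: "\<And>i. i < n \<Longrightarrow> regular_size_distribution w\<^sub>0 l \<gamma>\<^sub>1 \<gamma>\<^sub>2 (F i)"
      and \<beta>: "\<beta> \<le> (\<Sum>i<n. p i * r i * F i w\<^sub>0)" and T: "T \<ge> max N 1" for n p r F \<mu> T
  proof -
    define s where "s = a * real T powr (- e)"
    define q where "q = (l * s / w\<^sub>0) powr \<alpha>"
    have s: "0 < s" "s \<le> w\<^sub>0" "s \<le> c k / 4"
      using N[of T] T a by (auto simp: s_def)
    have q: "q = C * a powr \<alpha> * real T powr (- (e * \<alpha>))"
      using assms a s by (auto simp: q_def s_def C_def powr_mult powr_divide powr_powr)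
    have q0: "0 < q"
      using assms s by (simp add: q_def)
    have Tpow: "real T * real T powr (- (e * \<alpha>)) = real T powr e"
      using T e by (simp add: powr_mult_base) (metis add.commute add_diff_cancel_right' uminus_add_conv_diff)
    have load: "real T * (s * q) = c k / 4"
    proof -
      have "real T * (s * q) = (a * a powr \<alpha> * C) * (real T powr (- e) * (real T * real T powr (- (e * \<alpha>))))"
        by (simp add: s_def q)
      also have "\<dots> = c k / 4"
        unfolding aC Tpow using T by (simp flip: powr_add)
      finally show ?thesis .
    qed
    from F assms s have "\<forall>i. \<exists>v. i < n \<longrightarrow> v \<le> s \<and> F i v = q * F i w\<^sub>0"
      using regular_size_distribution_threshold unfolding q_def by blast
    then obtain b where b: "\<And>i. i < n \<Longrightarrow> b i \<le> s" "\<And>i. i < n \<Longrightarrow> F i (b i) = q * F i w\<^sub>0"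
      by metis
    define S where "S = (\<Union>i<n. {r i} \<times> {0<..b i})"
    note S = request_law_thresholds[OF law, of b, folded S_def]
    have r: "\<And>i. i < n \<Longrightarrow> 0 \<le> r i" and p: "\<And>i. i < n \<Longrightarrow> 0 \<le> p i" "(\<Sum>i<n. p i) = 1"
      and \<mu>: "prob_space \<mu>" "sets \<mu> = sets borel"
      using law by (auto simp: request_law_def)
    have "measure \<mu> S \<le> (\<Sum>i<n. p i * q)"
      unfolding S(2) using b p q0 regular_size_distribution_cdf(4)[OF F]
      by (intro sum_mono) (auto intro!: mult_left_mono simp: mult_left_le)
    then have mS: "measure \<mu> S \<le> q"
      using p by (simp flip: sum_distrib_right)
    have \<rho>: "q * \<beta> \<le> (\<integral>z. fst z * indicator S z \<partial>\<mu>)"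
      unfolding S(3) using mult_left_mono[OF \<beta>, of q] q0 b
      by (simp add: sum_distrib_left mult_ac)
    have "0 < q * \<beta>" using q0 \<open>0 < \<beta>\<close> by simp
    with \<rho> have \<rho>0: "0 \<le> (\<integral>z. fst z * indicator S z \<partial>\<mu>)" by linarith
    have "real T * (s * measure \<mu> S) \<le> c k / 4"
      unfolding load[symmetric] using mS s by (intro mult_left_mono) auto
    then have half: "1 / 2 \<le> 1 - (s + real T * (s * measure \<mu> S)) / c k"
      using s k by (simp add: field_simps)
    have "\<kappa> * real T powr (1 / (1 + \<alpha>)) = real T * (q * \<beta>) * (1 / 2)"
      unfolding \<kappa>_def e_def[symmetric] Tpow[symmetric] by (simp add: q)
    also have "\<dots> \<le> real T * (\<integral>z. fst z * indicator S z \<partial>\<mu>)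
        * (1 - (s + real T * (s * measure \<mu> S)) / c k)"
      using \<rho> half \<rho>0 by (intro mult_mono mult_left_mono mult_nonneg_nonneg) auto
    also have "\<dots> \<le> expected_prophet_value m c T \<mu>"
    proof (rule expected_prophet_value_ge_acceptance_set[OF \<mu> _ \<open>\<forall>j<m. 0 \<le> c j\<close> k S(1)])
      show "integrable \<mu> fst"
        using request_law_integrable_reward[OF law] regular_size_distribution_cdf(6)[OF F] by blast
      show "0 \<le> fst z \<and> 0 \<le> snd z \<and> snd z \<le> s" if "z \<in> S" for z
        using that r b(1) by (force simp: S_def)
    qed (use s in simp)
    finally show ?thesis .
  qed
  then show ?thesis
    using \<kappa> by blast
qed

end
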